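(* Let $\mathfrak{g}=A_{5,1}$ and let $\langle\cdot,\cdot\rangle$ be an inner product on $\mathfrak{g}$. Let $\eta>0$ and let $\{v_1,\dots,v_5\}$ be a basis of $\mathfrak{g}$, orthonormal with respect to $\eta\langle\cdot,\cdot\rangle$, whose only nonzero brackets (up to antisymmetry) are $[v_1,v_2]=\alpha v_4+\beta v_5$, $[v_1,v_3]=\gamma v_5$, with $\alpha,\gamma>0$ and $\beta\in\mathbb{R}$. Then $\langle\cdot,\cdot\rangle$ is a nilsoliton if and only if $\beta=0$ and $\alpha=\gamma$.
   Context: $A_{5,1}$ is the five-dimensional real nilpotent Lie algebra having a basis with the brackets displayed in the claim. An inner product on $\mathfrak{g}$ is identified with the left-invariant Riemannian metric $g$ it induces on the simply connected Lie group $G$ with Lie algebra $\mathfrak{g}$. Let $ric_g$ be the Ricci curvature tensor of $(G,g)$ (Levi-Civita connection), viewed as a symmetric bilinear form on $\mathfrak{g}$; since $\mathfrak{g}$ is nilpotent, $ric_g(u,v)=-\frac12\mathrm{tr}(ad_u\circ ad_v^* )-\frac14\mathrm{tr}(J_u\circ J_v)$, where $ad_uv=[u,v]$, $ad_v^*$ is the $g$-transpose of $ad_v$, and $J_uv=ad_v^*u$. The Ricci operator $Ric_g$ is defined by $ric_g(u,v)=g(Ric_g(u),v)$. The metric $g$ is a nilsoliton if $Ric_g\in\mathbb{R}\,\mathrm{Id}_{\mathfrak{g}}\oplus Der(\mathfrak{g})$, i.e. $Ric_g=c\,\mathrm{Id}+D$ for some $c\in\mathbb{R}$ and some derivation $D$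 of $\mathfrak{g}$. *)

theory Defs
  imports "HOL-Analysis.Analysis"
begin

(* The underlying real vector space is the whole type 'a; the bracket and the inner product are
   explicit arguments, unrelated to any type-class structure on 'a. *)

definition lie_bracket :: "('a::real_vector \<Rightarrow> 'a \<Rightarrow> 'a) \<Rightarrow> bool" where
  "lie_bracket br \<longleftrightarrow> bilinear br \<and> (\<forall>u. br u u = 0) \<and>
     (\<forall>u v w. br u (br v w) + br v (br w u) + br w (br u v) = 0)"

definition inner_product :: "('a::real_vector \<Rightarrow> 'a \<Rightarrow> real) \<Rightarrow> bool" where
  "inner_product g \<longleftrightarrow> bilinear g \<and> (\<forall>u v. g u v = g v u) \<and> (\<forall>u. u \<noteq> 0 \<longrightarrow> g u u > 0)"

definition indexed_basis :: "nat set \<Rightarrow> (nat \<Rightarrow> 'a::real_vector) \<Rightarrow> bool" where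
  "indexed_basis I v \<longleftrightarrow> inj_on v I \<and> independent (v ` I) \<and> span (v ` I) = UNIV"

definition orthonormal_on :: "('a \<Rightarrow> 'a \<Rightarrow> real) \<Rightarrow> nat set \<Rightarrow> (nat \<Rightarrow> 'a) \<Rightarrow> bool" where
  "orthonormal_on g I v \<longleftrightarrow> (\<forall>i\<in>I. \<forall>j\<in>I. g (v i) (v j) = (if i = j then 1 else 0))"

definition A51_brackets ::
  "('a::real_vector \<Rightarrow> 'a \<Rightarrow> 'a) \<Rightarrow> (nat \<Rightarrow> 'a) \<Rightarrow> real \<Rightarrow> real \<Rightarrow> real \<Rightarrow> bool" where
  "A51_brackets br v \<alpha> \<beta> \<gamma> \<longleftrightarrow>
     br (v 1) (v 2) = \<alpha> *\<^sub>R v 4 + \<beta> *\<^sub>R v 5 \<and>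
     br (v 1) (v 3) = \<gamma> *\<^sub>R v 5 \<and>
     (\<forall>i\<in>{1..5}. \<forall>j\<in>{1..5}. i < j \<and> (i, j) \<noteq> (1, 2) \<and> (i, j) \<noteq> (1, 3) \<longrightarrow> br (v i) (v j) = 0)"

(* Replacing v 4 by \<alpha> v 4 + \<beta> v 5 and v 5 by \<gamma> v 5 shows that every bracket of the above form with
   \<alpha>, \<gamma> nonzero is isomorphic to the one with \<alpha> = \<gamma> = 1 and \<beta> = 0. *)
definition is_A51 :: "('a::real_vector \<Rightarrow> 'a \<Rightarrow> 'a) \<Rightarrow> bool" where
  "is_A51 br \<longleftrightarrow> lie_bracket br \<and> (\<exists>e. indexed_basis {1..5} e \<and> A51_brackets br e 1 0 1)"

(* The trace does not depend on the basis chosen; meaningful for finite-dimensional 'a only. *)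
definition endo_trace :: "('a::real_vector \<Rightarrow> 'a) \<Rightarrow> real" where
  "endo_trace f = (let B = (SOME B. independent B \<and> span B = UNIV)
     in \<Sum>b\<in>B. representation B (f b) b)"

(* Left-invariant tensors on the simply connected group are identified with their values at the
   identity. The Levi-Civita connection of a left-invariant metric sends left-invariant fields to
   left-invariant fields, and the product g v w of two such fields is a constant function, so
   metric compatibility X (g v w) = g (nab X v) w + g v (nab X w) has left-hand side 0. *)
definition is_levi_civita ::
  "('a::real_vector \<Rightarrow> 'a \<Rightarrow> 'a) \<Rightarrow> ('a \<Rightarrow> 'a \<Rightarrow> real) \<Rightarrow> ('a \<Rightarrow> 'a \<Rightarrow> 'a) \<Rightarrow> bool" where
  "is_levi_civita br g nab \<longleftrightarrow> bilinear nab \<and>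
     (\<forall>u v. nab u v - nab v u = br u v) \<and>
     (\<forall>u v w. g (nab u v) w + g v (nab u w) = 0)"

definition levi_civita ::
  "('a::real_vector \<Rightarrow> 'a \<Rightarrow> 'a) \<Rightarrow> ('a \<Rightarrow> 'a \<Rightarrow> real) \<Rightarrow> 'a \<Rightarrow> 'a \<Rightarrow> 'a" where
  "levi_civita br g = (THE nab. is_levi_civita br g nab)"

definition curvature ::
  "('a::real_vector \<Rightarrow> 'a \<Rightarrow> 'a) \<Rightarrow> ('a \<Rightarrow> 'a \<Rightarrow> real) \<Rightarrow> 'a \<Rightarrow> 'a \<Rightarrow> 'a \<Rightarrow> 'a" where
  "curvature br g u v w =
     (let nab = levi_civita br g in nab u (nab v w) - nab v (nab u w) - nab (br u v) w)"

(* With these signs round spheres have positive Ricci curvature, and for nilpotent br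
   ric br g u v = - 1/2 tr (ad_u o ad_v^T) - 1/4 tr (J_u o J_v), where J_u v = ad_v^T u. *)
definition ric ::
  "('a::real_vector \<Rightarrow> 'a \<Rightarrow> 'a) \<Rightarrow> ('a \<Rightarrow> 'a \<Rightarrow> real) \<Rightarrow> 'a \<Rightarrow> 'a \<Rightarrow> real" where
  "ric br g u v = endo_trace (\<lambda>w. curvature br g w u v)"

definition Ric ::
  "('a::real_vector \<Rightarrow> 'a \<Rightarrow> 'a) \<Rightarrow> ('a \<Rightarrow> 'a \<Rightarrow> real) \<Rightarrow> 'a \<Rightarrow> 'a" where
  "Ric br g = (THE A. linear A \<and> (\<forall>u v. ric br g u v = g (A u) v))"

definition derivation :: "('a::real_vector \<Rightarrow> 'a \<Rightarrow> 'a) \<Rightarrow> ('a \<Rightarrow> 'a) \<Rightarrow> bool" where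
  "derivation br D \<longleftrightarrow> linear D \<and> (\<forall>u v. D (br u v) = br (D u) v + br u (D v))"

definition nilsoliton :: "('a::real_vector \<Rightarrow> 'a \<Rightarrow> 'a) \<Rightarrow> ('a \<Rightarrow> 'a \<Rightarrow> real) \<Rightarrow> bool" where
  "nilsoliton br g \<longleftrightarrow> (\<exists>c D. derivation br D \<and> (\<forall>u. Ric br g u = c *\<^sub>R u + D u))"

end

theory Submission
  imports Defs
begin

text \<open>
  Rescaling the metric changes the Ricci operator only by a factor, so one may take
  \<open>v\<close> itself orthonormal. In this frame \<open>2 Ric\<close> is block diagonal: it is
  \<open>-(\<alpha>\<^sup>2 + \<beta>\<^sup>2 + \<gamma>\<^sup>2)\<close> on \<open>v 1\<close>, minus the Gram matrix of
  \<open>ad (v 1)\<close> on \<open>v 2, v 3\<close>, and the corresponding dual Gram matrix on the centre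
  \<open>v 4, v 5\<close>. Testing \<open>Ric - c Id\<close> on \<open>[v 1, v 3]\<close> gives
  \<open>\<alpha> \<beta> \<gamma> = 0\<close> from the \<open>v 4\<close>-component and
  \<open>-2c = \<alpha>\<^sup>2 + 3\<beta>\<^sup>2 + 3\<gamma>\<^sup>2\<close> from the
  \<open>v 5\<close>-component, while the \<open>v 4\<close>-component on \<open>[v 1, v 2]\<close> gives
  \<open>-2c = 3\<alpha>\<^sup>2 + 3\<beta>\<^sup>2 + \<gamma>\<^sup>2\<close>; hence
  \<open>\<alpha> = \<gamma>\<close>, and conversely \<open>c = -2\<alpha>\<^sup>2\<close> works.
\<close>

section \<open>Basis independence of the trace\<close>

text \<open>\<open>endo_trace\<close> picks its basis by choice; this lets any finite basis compute
  it. The reason is tr(PQ) = tr(QP): \<open>f b\<close> is expanded in \<open>C\<close>, the sums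
  are swapped, and linearity of \<open>f\<close> recombines the sum over \<open>B\<close>.\<close>

lemma endo_trace_basis:
  fixes f :: "'a::real_vector \<Rightarrow> 'a"
  assumes f: "linear f" and C: "finite C" "independent C" "span C = UNIV"
  shows "endo_trace f = (\<Sum>c\<in>C. representation C (f c) c)"
proof -
  define B where "B = (SOME B::'a set. independent B \<and> span B = UNIV)"
  have B: "independent B" "span B = UNIV"
    unfolding B_def using someI_ex[of "\<lambda>B::'a set. independent B \<and> span B = UNIV"] C by blast+
  have finB: "finite B"
    using independent_span_bound[OF C(1) B(1)] C(3) by auto
  interpret f: linear f by (rule f)
  have expand: "representation X (f y) x = (\<Sum>z\<in>Z. representation Z y z * representation X (f z) x)"
    if X: "independent X" "span X = UNIV" and Z: "finite Z" "independent Z" "span Z = UNIV"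
    for X Z x y
  proof -
    have "y = (\<Sum>z\<in>Z. representation Z y z *\<^sub>R z)"
      using sum_representation_eq[of Z y Z] Z by auto
    then have "f y = (\<Sum>z\<in>Z. representation Z y z *\<^sub>R f z)"
      by (metis (no_types, lifting) f.scaleR f.sum sum.cong)
    then show ?thesis
      using X by (simp add: representation_sum representation_scale)
  qed
  have "endo_trace f = (\<Sum>b\<in>B. representation B (f b) b)"
    by (simp add: endo_trace_def B_def Let_def)
  also have "\<dots> = (\<Sum>b\<in>B. \<Sum>c\<in>C. representation C (f b) c * representation B c b)"
  proof (rule sum.cong[OF refl])
    fix b
    have "f b = (\<Sum>c\<in>C. representation C (f b) c *\<^sub>R c)"
      using sum_representation_eq[of C "f b" C] C by auto
    then have "representation B (f b) b = representation B (\<Sum>c\<in>C. representation C (f b) c *\<^sub>R c) b"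
      by simp
    also have "\<dots> = (\<Sum>c\<in>C. representation C (f b) c * representation B c b)"
      using B by (simp add: representation_sum representation_scale)
    finally show "representation B (f b) b = \<dots>" .
  qed
  also have "\<dots> = (\<Sum>c\<in>C. \<Sum>b\<in>B. representation B c b * representation C (f b) c)"
    by (subst sum.swap) (simp add: mult.commute)
  also have "\<dots> = (\<Sum>c\<in>C. representation C (f c) c)"
    by (simp add: expand[OF C(2,3) finB B, symmetric])
  finally show ?thesis .
qed

section \<open>Uniqueness of the Levi-Civita connection and of the Ricci operator\<close>

text \<open>The Koszul formula determines \<open>g (k u w) z\<close> from \<open>br\<close> and
  \<open>g\<close> alone, so the values of two such connections differ by a vector orthogonal to
  everything.\<close>

lemma is_levi_civita_unique:
  assumes g: "inner_product g" and "is_levi_civita br g n" "is_levi_civita br g m"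
  shows "n = m"
proof (intro ext)
  fix u w
  have bl: "bilinear g" and sym: "g x y = g y x" and pos: "x \<noteq> 0 \<Longrightarrow> g x x > 0" for x y
    using g by (auto simp: inner_product_def)
  have koszul: "2 * g (k u w) z = g (br u w) z + g (br z w) u + g (br z u) w"
    if "is_levi_civita br g k" for k z
  proof -
    have br: "br x y = k x y - k y x" and met: "g (k x y) t + g y (k x t) = 0" for x y t
      using that by (auto simp: is_levi_civita_def)
    have *: "g (br x y) t = g (k x y) t - g (k y x) t" for x y t
      by (simp only: br bilinear_lsub[OF bl])
    show ?thesis
      \<comment> \<open>The first compatibility instance doubles \<open>g (k u w) z\<close>; the
        other two cancel the remaining terms.\<close>
      using met[of u w z] met[of w u z] met[of z u w] sym[of w "k u z"] sym[of u "k w z"]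
        sym[of u "k z w"]
      by (simp add: *)
  qed
  have "g (n u w - m u w) z = 0" for z
    using koszul[OF assms(2), of z] koszul[OF assms(3), of z] by (simp add: bilinear_lsub[OF bl])
  then show "n u w = m u w"
    using pos[of "n u w - m u w"] by auto
qed

lemma levi_civita_eqI:
  "inner_product g \<Longrightarrow> is_levi_civita br g n \<Longrightarrow> levi_civita br g = n"
  unfolding levi_civita_def using is_levi_civita_unique by blast

lemma Ric_eqI:
  assumes g: "inner_product g" and A: "linear A" "\<And>u v. ric br g u v = g (A u) v"
  shows "Ric br g = A"
  unfolding Ric_def
proof (rule the_equality)
  show "linear A \<and> (\<forall>u v. ric br g u v = g (A u) v)"
    using A by blast
next
  fix A' assume A': "linear A' \<and> (\<forall>u v. ric br g u v = g (A' u) v)"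
  show "A' = A"
  proof
    fix u
    have "g (A' u - A u) (A' u - A u) = 0"
      using g A(2)[of u "A' u - A u"] A' by (auto simp: inner_product_def bilinear_lsub)
    moreover have "x \<noteq> 0 \<Longrightarrow> g x x \<noteq> 0" for x
      using g by (simp add: inner_product_def less_imp_neq[symmetric])
    ultimately show "A' u = A u"
      using eq_iff_diff_eq_0 by blast
  qed
qed

section \<open>Rescaling the metric\<close>

lemma inner_product_scale:
  assumes "inner_product g" "\<eta> > 0"
  shows "inner_product (\<lambda>x y. \<eta> * g x y)"
proof -
  have "linear (\<lambda>y. \<eta> * g x y)" "linear (\<lambda>x. \<eta> * g x y)" for x y
    using assms(1) linear_compose_scale_right[of "g x" \<eta>]
      linear_compose_scale_right[of "\<lambda>x. g x y" \<eta>]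
    by (simp_all add: inner_product_def bilinear_def)
  then show ?thesis
    using assms by (simp add: inner_product_def bilinear_def)
qed

text \<open>Metric compatibility is homogeneous in the metric, so the connection is unchanged;
  curvature and its trace see the metric only through the connection.\<close>

lemma ric_scale:
  assumes "\<eta> \<noteq> 0"
  shows "ric br (\<lambda>x y. \<eta> * g x y) = ric br g"
proof -
  have "is_levi_civita br (\<lambda>x y. \<eta> * g x y) = is_levi_civita br g"
    using assms by (auto simp: is_levi_civita_def fun_eq_iff distrib_left[symmetric])
  then show ?thesis
    by (simp add: ric_def curvature_def levi_civita_def fun_eq_iff)
qed

text \<open>Here \<open>A\<close> is the Ricci operator of the rescaled metric. As
  \<open>ric\<close> ignores the factor, the operator of \<open>g\<close> is \<eta> times
  \<open>A\<close>; derivations are closed under scalar multiples, so the soliton condition can be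
  tested on \<open>A\<close> with a rescaled constant.\<close>

lemma nilsoliton_iff_scaled:
  assumes g: "inner_product g" and "\<eta> > 0" and A: "linear A"
    and ric: "\<And>u v. ric br (\<lambda>x y. \<eta> * g x y) u v = \<eta> * g (A u) v"
    and br: "bilinear br"
  shows "nilsoliton br g \<longleftrightarrow> (\<exists>c. derivation br (\<lambda>u. A u - c *\<^sub>R u))"
proof -
  have Ric: "Ric br g = (\<lambda>u. \<eta> *\<^sub>R A u)"
  proof (rule Ric_eqI[OF g])
    show "linear (\<lambda>u. \<eta> *\<^sub>R A u)"
      using A by (rule linear_compose_scale_right)
    show "ric br g u v = g (\<eta> *\<^sub>R A u) v" for u v
    proof -
      have "bilinear g" using g by (simp add: inner_product_def)
      then show ?thesis using ric[of u v] \<open>\<eta> > 0\<close> by (simp add: ric_scale bilinear_lmul)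
    qed
  qed
  have scale: "derivation br (\<lambda>u. k *\<^sub>R D u)" if "derivation br D" for k D
    using that br
    by (auto simp: derivation_def linear_compose_scale_right bilinear_lmul bilinear_rmul scaleR_add_right)
  show ?thesis
  proof
    assume "nilsoliton br g"
    then obtain c D where D: "derivation br D" "\<And>u. \<eta> *\<^sub>R A u = c *\<^sub>R u + D u"
      by (auto simp: nilsoliton_def Ric)
    have "A u - (c / \<eta>) *\<^sub>R u = (1 / \<eta>) *\<^sub>R D u" for u
    proof -
      have "A u = (1 / \<eta>) *\<^sub>R (\<eta> *\<^sub>R A u)"
        using \<open>\<eta> > 0\<close> by simp
      also have "\<dots> = (1 / \<eta>) *\<^sub>R (c *\<^sub>R u + D u)"
        by (simp only: D(2))
      finally show ?thesis
        by (simp add: scaleR_add_right)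
    qed
    then show "\<exists>c. derivation br (\<lambda>u. A u - c *\<^sub>R u)"
      using scale[OF D(1), of "1 / \<eta>"] by (intro exI[of _ "c / \<eta>"]) simp
  next
    assume "\<exists>c. derivation br (\<lambda>u. A u - c *\<^sub>R u)"
    then obtain c where "derivation br (\<lambda>u. A u - c *\<^sub>R u)" ..
    from scale[OF this, of \<eta>] show "nilsoliton br g"
      unfolding nilsoliton_def Ric
      by (intro exI[of _ "\<eta> * c"] exI[of _ "\<lambda>u. \<eta> *\<^sub>R (A u - c *\<^sub>R u)"])
        (simp add: scaleR_diff_right)
  qed
qed

section \<open>Coordinates and traces in an orthonormal frame\<close>

lemma orthonormal_expansion:
  assumes g: "inner_product g" and I: "finite I"
    and v: "indexed_basis I v" "orthonormal_on g I v"
  shows "x = (\<Sum>i\<in>I. g x (v i) *\<^sub>R v i)"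
    and "i \<in> I \<Longrightarrow> representation (v ` I) x (v i) = g x (v i)"
proof -
  have inj: "inj_on v I" and ind: "independent (v ` I)" and sp: "span (v ` I) = UNIV"
    using v by (auto simp: indexed_basis_def)
  have bl: "bilinear g" using g by (simp add: inner_product_def)
  define r where "r = representation (v ` I) x"
  have x: "x = (\<Sum>i\<in>I. r (v i) *\<^sub>R v i)"
    using sum_representation_eq[OF ind _ finite_imageI[OF I] order_refl, of x] sp inj
    by (simp add: r_def sum.reindex)
  have r: "g x (v i) = r (v i)" if i: "i \<in> I" for i
  proof -
    interpret l: linear "\<lambda>x. g x (v i)" using bl by (simp add: bilinear_def)
    have "g x (v i) = (\<Sum>j\<in>I. r (v j) * g (v j) (v i))"
      by (subst x) (simp add: l.sum l.scaleR)
    also have "\<dots> = (\<Sum>j\<in>I. if j = i then r (v j) else 0)"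
      using v(2) i by (intro sum.cong) (auto simp: orthonormal_on_def)
    finally show ?thesis using I i by simp
  qed
  show "x = (\<Sum>i\<in>I. g x (v i) *\<^sub>R v i)"
    by (subst (1) x) (simp add: r)
  show "i \<in> I \<Longrightarrow> representation (v ` I) x (v i) = g x (v i)"
    by (simp add: r r_def)
qed

lemma endo_trace_orthonormal:
  assumes "linear f" "inner_product g" "finite I" "indexed_basis I v" "orthonormal_on g I v"
  shows "endo_trace f = (\<Sum>i\<in>I. g (f (v i)) (v i))"
  using assms endo_trace_basis[of f "v ` I"] orthonormal_expansion(2)[OF assms(2-5)]
  by (simp add: indexed_basis_def sum.reindex)

lemma sum_1_to_5: "sum f {1..5::nat} = f 1 + f 2 + f 3 + f 4 + f 5"
  by (simp add: numeral_eq_Suc add.assoc)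

lemma ball_1_to_5: "(\<forall>i\<in>{1..5::nat}. P i) \<longleftrightarrow> P 1 \<and> P 2 \<and> P 3 \<and> P 4 \<and> P 5"
proof -
  have "{1..5::nat} = {1, 2, 3, 4, 5}" by auto
  then show ?thesis by simp
qed

section \<open>Bracket, connection and Ricci curvature in the given frame\<close>

locale A51_frame =
  fixes br :: "'a::real_vector \<Rightarrow> 'a \<Rightarrow> 'a"
    and h :: "'a \<Rightarrow> 'a \<Rightarrow> real"
    and v :: "nat \<Rightarrow> 'a"
    and \<alpha> \<beta> \<gamma> :: real
  assumes lie: "lie_bracket br"
    and ip: "inner_product h"
    and basis: "indexed_basis {1..5} v"
    and orthonormal: "orthonormal_on h {1..5} v"
    and brackets: "A51_brackets br v \<alpha> \<beta> \<gamma>"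
begin

text \<open>Keeps \<open>v 1\<close> from turning into \<open>v (Suc 0)\<close>, so that the frame
  equations still match.\<close>

declare One_nat_def [simp del]

lemma bilinear_h: "bilinear h" and h_sym: "h x y = h y x"
  using ip by (auto simp: inner_product_def)

lemma bilinear_br: "bilinear br"
  using lie by (simp add: lie_bracket_def)

lemma br_anti: "br y x = - br x y"
proof -
  have "br (x + y) (x + y) = 0" "br x x = 0" "br y y = 0"
    using lie by (auto simp: lie_bracket_def)
  then show ?thesis
    by (simp add: bilinear_ladd[OF bilinear_br] bilinear_radd[OF bilinear_br] add_eq_0_iff)
qed

lemmas h_simps = bilinear_ladd[OF bilinear_h] bilinear_radd[OF bilinear_h]
  bilinear_lsub[OF bilinear_h] bilinear_rsub[OF bilinear_h]
  bilinear_lmul[OF bilinear_h] bilinear_rmul[OF bilinear_h]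
  bilinear_lneg[OF bilinear_h] bilinear_rneg[OF bilinear_h]
  bilinear_lzero[OF bilinear_h] bilinear_rzero[OF bilinear_h]

lemmas br_simps = bilinear_ladd[OF bilinear_br] bilinear_radd[OF bilinear_br]
  bilinear_lmul[OF bilinear_br] bilinear_rmul[OF bilinear_br]

lemmas h_frame = orthonormal[unfolded orthonormal_on_def ball_1_to_5, simplified]

lemma expansion:
  "x = h x (v 1) *\<^sub>R v 1 + h x (v 2) *\<^sub>R v 2 + h x (v 3) *\<^sub>R v 3 + h x (v 4) *\<^sub>R v 4 + h x (v 5) *\<^sub>R v 5"
  using orthonormal_expansion(1)[OF ip _ basis orthonormal, of x] by (simp add: sum_1_to_5)

text \<open>Parseval's identity; it brings metric compatibility and the Ricci form down to
  coordinates.\<close>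

lemma h_expansion:
  "h x y = h x (v 1) * h y (v 1) + h x (v 2) * h y (v 2) + h x (v 3) * h y (v 3)
     + h x (v 4) * h y (v 4) + h x (v 5) * h y (v 5)"
  by (subst (1) expansion[of y]) (simp add: h_simps algebra_simps)

lemma frame_eqI:
  assumes "h x (v 1) = h y (v 1)" "h x (v 2) = h y (v 2)" "h x (v 3) = h y (v 3)"
    "h x (v 4) = h y (v 4)" "h x (v 5) = h y (v 5)"
  shows "x = y"
  by (subst expansion[of x], subst expansion[of y]) (simp add: assms)

lemma br_frame:
  "br x y = (h x (v 1) * h y (v 2) - h x (v 2) * h y (v 1)) *\<^sub>R (\<alpha> *\<^sub>R v 4 + \<beta> *\<^sub>R v 5)
     + (h x (v 1) * h y (v 3) - h x (v 3) * h y (v 1)) *\<^sub>R (\<gamma> *\<^sub>R v 5)"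
proof -
  have z: "br x x = 0" for x
    using lie by (simp add: lie_bracket_def)
  note up = brackets[unfolded A51_brackets_def ball_1_to_5, simplified]
  \<comment> \<open>\<open>A51_brackets\<close> fixes only pairs with \<open>i < j\<close>; these
    give the reversed pairs, and \<open>z\<close> the diagonal.\<close>
  note down = br_anti[of "v 2" "v 1"] br_anti[of "v 3" "v 1"] br_anti[of "v 4" "v 1"]
    br_anti[of "v 5" "v 1"] br_anti[of "v 3" "v 2"] br_anti[of "v 4" "v 2"] br_anti[of "v 5" "v 2"]
    br_anti[of "v 4" "v 3"] br_anti[of "v 5" "v 3"] br_anti[of "v 5" "v 4"]
  show ?thesis
    by (subst expansion[of x], subst expansion[of y])
      (simp add: br_simps up down z algebra_simps)
qed

lemma br_coords:
  "h (br x y) (v 1) = 0" "h (br x y) (v 2) = 0" "h (br x y) (v 3) = 0"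
  "h (br x y) (v 4) = \<alpha> * (h x (v 1) * h y (v 2) - h x (v 2) * h y (v 1))"
  "h (br x y) (v 5) = \<beta> * (h x (v 1) * h y (v 2) - h x (v 2) * h y (v 1))
     + \<gamma> * (h x (v 1) * h y (v 3) - h x (v 3) * h y (v 1))"
  by (simp_all add: br_frame h_simps h_frame)

text \<open>The Koszul formula in the given frame.\<close>

definition nab :: "'a \<Rightarrow> 'a \<Rightarrow> 'a" where
  "nab x y = (1/2) *\<^sub>R (br x y
     + (\<alpha> * (h x (v 4) * h y (v 2) + h x (v 2) * h y (v 4))
        + \<beta> * (h x (v 5) * h y (v 2) + h x (v 2) * h y (v 5))
        + \<gamma> * (h x (v 5) * h y (v 3) + h x (v 3) * h y (v 5))) *\<^sub>R v 1
     - (\<alpha> * (h x (v 4) * h y (v 1) + h x (v 1) * h y (v 4))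
        + \<beta> * (h x (v 5) * h y (v 1) + h x (v 1) * h y (v 5))) *\<^sub>R v 2
     - (\<gamma> * (h x (v 5) * h y (v 1) + h x (v 1) * h y (v 5))) *\<^sub>R v 3)"

lemma nab_coords:
  "h (nab x y) (v 1) = (\<alpha> * (h x (v 4) * h y (v 2) + h x (v 2) * h y (v 4))
        + \<beta> * (h x (v 5) * h y (v 2) + h x (v 2) * h y (v 5))
        + \<gamma> * (h x (v 5) * h y (v 3) + h x (v 3) * h y (v 5))) / 2"
  "h (nab x y) (v 2) = - (\<alpha> * (h x (v 4) * h y (v 1) + h x (v 1) * h y (v 4))
        + \<beta> * (h x (v 5) * h y (v 1) + h x (v 1) * h y (v 5))) / 2"
  "h (nab x y) (v 3) = - \<gamma> * (h x (v 5) * h y (v 1) + h x (v 1) * h y (v 5)) / 2"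
  "h (nab x y) (v 4) = \<alpha> * (h x (v 1) * h y (v 2) - h x (v 2) * h y (v 1)) / 2"
  "h (nab x y) (v 5) = (\<beta> * (h x (v 1) * h y (v 2) - h x (v 2) * h y (v 1))
     + \<gamma> * (h x (v 1) * h y (v 3) - h x (v 3) * h y (v 1))) / 2"
  by (simp_all add: nab_def h_simps h_frame br_coords)

lemma bilinear_nab: "bilinear nab"
  unfolding bilinear_def
  by (intro conjI allI linearI frame_eqI)
    (simp_all add: nab_coords h_simps algebra_simps add_divide_distrib diff_divide_distrib)

lemma levi_civita_eq: "levi_civita br h = nab"
proof (rule levi_civita_eqI[OF ip])
  \<comment> \<open>The correction terms along \<open>v 1\<close>, \<open>v 2\<close>,
    \<open>v 3\<close> are symmetric in the arguments and cancel; the two halves of the bracket add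
    up.\<close>
  have "nab x y - nab y x = br x y" for x y
    by (rule frame_eqI) (simp_all add: nab_coords br_coords h_simps field_simps)
  moreover have "h (nab x y) z + h y (nab x z) = 0" for x y z
  proof -
    \<comment> \<open>With both derivatives in the first slot, \<open>h_expansion\<close> and
      \<open>nab_coords\<close> turn skew-symmetry of \<open>nab x\<close> into a polynomial
      identity.\<close>
    have "h (nab x y) z + h (nab x z) y = 0"
      by (simp add: h_expansion[of "nab x y" z] h_expansion[of "nab x z" y] nab_coords)
        (simp add: algebra_simps add_divide_distrib diff_divide_distrib)
    then show ?thesis
      by (simp only: h_sym[of y "nab x z"])
  qed
  ultimately show "is_levi_civita br h nab"
    unfolding is_levi_civita_def using bilinear_nab by blast
qed

text \<open>In the nilpotent Ricci formula the \<open>ad\<close> term vanishes on the central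
  vectors \<open>v 4\<close>, \<open>v 5\<close>, and the \<open>J\<close> term on
  \<open>v 1\<close>, \<open>v 2\<close>, \<open>v 3\<close>, which are orthogonal to all brackets.
  This explains the two blocks and their signs.\<close>

definition ricci :: "'a \<Rightarrow> 'a" where
  "ricci x = (1/2) *\<^sub>R (
     - ((\<alpha>\<^sup>2 + \<beta>\<^sup>2 + \<gamma>\<^sup>2) * h x (v 1)) *\<^sub>R v 1
     - ((\<alpha>\<^sup>2 + \<beta>\<^sup>2) * h x (v 2) + \<beta> * \<gamma> * h x (v 3)) *\<^sub>R v 2
     - (\<beta> * \<gamma> * h x (v 2) + \<gamma>\<^sup>2 * h x (v 3)) *\<^sub>R v 3
     + (\<alpha>\<^sup>2 * h x (v 4) + \<alpha> * \<beta> * h x (v 5)) *\<^sub>R v 4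
     + (\<alpha> * \<beta> * h x (v 4) + (\<beta>\<^sup>2 + \<gamma>\<^sup>2) * h x (v 5)) *\<^sub>R v 5)"

lemma ricci_coords:
  "h (ricci x) (v 1) = - ((\<alpha>\<^sup>2 + \<beta>\<^sup>2 + \<gamma>\<^sup>2) * h x (v 1)) / 2"
  "h (ricci x) (v 2) = - ((\<alpha>\<^sup>2 + \<beta>\<^sup>2) * h x (v 2) + \<beta> * \<gamma> * h x (v 3)) / 2"
  "h (ricci x) (v 3) = - (\<beta> * \<gamma> * h x (v 2) + \<gamma>\<^sup>2 * h x (v 3)) / 2"
  "h (ricci x) (v 4) = (\<alpha>\<^sup>2 * h x (v 4) + \<alpha> * \<beta> * h x (v 5)) / 2"
  "h (ricci x) (v 5) = (\<alpha> * \<beta> * h x (v 4) + (\<beta>\<^sup>2 + \<gamma>\<^sup>2) * h x (v 5)) / 2"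
  by (simp_all add: ricci_def h_simps h_frame)

lemma linear_ricci: "linear ricci"
  by (intro linearI frame_eqI)
    (simp_all add: ricci_coords h_simps algebra_simps add_divide_distrib diff_divide_distrib)

lemma ric_eq: "ric br h x y = h (ricci x) y"
proof -
  have lin: "linear (\<lambda>w. curvature br h w x y)"
    unfolding curvature_def levi_civita_eq Let_def
    by (intro linearI frame_eqI)
      (simp_all add: nab_coords br_coords h_simps algebra_simps add_divide_distrib diff_divide_distrib)
  show ?thesis
    \<comment> \<open>The trace is rewritten while \<open>curvature\<close> is still folded, the
      form in which \<open>lin\<close> is stated.\<close>
    unfolding ric_def endo_trace_orthonormal[OF lin ip finite_atLeastAtMost basis orthonormal]
      sum_1_to_5
    unfolding curvature_def levi_civita_eq Let_def
    by (subst h_expansion[of "ricci x"])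
      (simp add: nab_coords br_coords ricci_coords h_simps h_frame field_simps power2_eq_square)
qed

section \<open>The derivation condition\<close>

lemma derivation_ricci_iff:
  assumes "\<alpha> > 0" "\<gamma> > 0"
  shows "(\<exists>c. derivation br (\<lambda>u. ricci u - c *\<^sub>R u)) \<longleftrightarrow> \<beta> = 0 \<and> \<alpha> = \<gamma>"
proof
  assume "\<exists>c. derivation br (\<lambda>u. ricci u - c *\<^sub>R u)"
  then obtain c where D: "\<And>x y. ricci (br x y) - c *\<^sub>R br x y
      = br (ricci x - c *\<^sub>R x) y + br x (ricci y - c *\<^sub>R y)"
    by (auto simp: derivation_def)
  have D': "h (ricci (br x y) - c *\<^sub>R br x y) z
      = h (br (ricci x - c *\<^sub>R x) y + br x (ricci y - c *\<^sub>R y)) z" for x y z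
    by (simp only: D)
  \<comment> \<open>The left side contributes \<alpha>\<beta>\<gamma>/2, from the off-diagonal entry
    of \<open>ricci\<close> on \<open>v 4\<close>, \<open>v 5\<close>; the right side contributes
    its negative, from the one on \<open>v 2\<close>, \<open>v 3\<close>.\<close>
  have "\<alpha> * \<beta> * \<gamma> = 0"
    using D'[of "v 1" "v 3" "v 4"]
    by (simp add: ricci_coords br_coords h_simps h_frame field_simps)
  then have \<beta>: "\<beta> = 0" using assms by simp
  have "\<gamma> * (2 * c + \<alpha>\<^sup>2 + 3 * \<beta>\<^sup>2 + 3 * \<gamma>\<^sup>2) = 0"
    using D'[of "v 1" "v 3" "v 5"]
    by (simp add: ricci_coords br_coords h_simps h_frame field_simps power2_eq_square)
  moreover have "\<alpha> * (2 * c + 3 * \<alpha>\<^sup>2 + 3 * \<beta>\<^sup>2 + \<gamma>\<^sup>2) = 0"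
    using D'[of "v 1" "v 2" "v 4"]
    by (simp add: ricci_coords br_coords h_simps h_frame field_simps power2_eq_square)
  ultimately have "2 * c + \<alpha>\<^sup>2 + 3 * \<beta>\<^sup>2 + 3 * \<gamma>\<^sup>2 = 0"
    "2 * c + 3 * \<alpha>\<^sup>2 + 3 * \<beta>\<^sup>2 + \<gamma>\<^sup>2 = 0"
    using assms by simp_all
  then have "\<alpha>\<^sup>2 = \<gamma>\<^sup>2"
    by linarith
  then show "\<beta> = 0 \<and> \<alpha> = \<gamma>"
    using \<beta> assms by (simp add: power2_eq_iff)
next
  assume *: "\<beta> = 0 \<and> \<alpha> = \<gamma>"
  \<comment> \<open>The constant solves the two equations above at \<beta> = 0, \<alpha> = \<gamma>.
    The operator is then diagonal with entries 1, 3/2, 3/2, 5/2, 5/2 times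
    \<open>\<alpha>\<^sup>2\<close>, and 1 + 3/2 = 5/2 is the derivation law for both
    brackets.\<close>
  have "linear (\<lambda>u. ricci u - (- 2 * \<alpha>\<^sup>2) *\<^sub>R u)"
    by (intro linear_compose_sub linear_ricci linear_scale_self)
  moreover have "ricci (br x y) - (- 2 * \<alpha>\<^sup>2) *\<^sub>R br x y
      = br (ricci x - (- 2 * \<alpha>\<^sup>2) *\<^sub>R x) y + br x (ricci y - (- 2 * \<alpha>\<^sup>2) *\<^sub>R y)" for x y
    by (intro frame_eqI; simp add: ricci_coords br_coords h_simps)
      (simp_all add: * field_simps)
  ultimately show "\<exists>c. derivation br (\<lambda>u. ricci u - c *\<^sub>R u)"
    unfolding derivation_def by blast
qed

end

theorem corollary7:
  fixes br :: "'a::real_vector \<Rightarrow> 'a \<Rightarrow> 'a"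
    and g :: "'a \<Rightarrow> 'a \<Rightarrow> real"
    and v :: "nat \<Rightarrow> 'a"
    and \<eta> \<alpha> \<beta> \<gamma> :: real
  assumes "is_A51 br"
    and "inner_product g"
    and "\<eta> > 0"
    and "indexed_basis {1..5} v"
    and "orthonormal_on (\<lambda>x y. \<eta> * g x y) {1..5} v"
    and "A51_brackets br v \<alpha> \<beta> \<gamma>"
    and "\<alpha> > 0" and "\<gamma> > 0"
  shows "nilsoliton br g \<longleftrightarrow> \<beta> = 0 \<and> \<alpha> = \<gamma>"
proof -
  \<comment> \<open>The frame is orthonormal for the rescaled metric, so that metric enters here;
    \<open>nilsoliton_iff_scaled\<close> leads back to \<open>g\<close>.\<close>
  interpret A51_frame br "\<lambda>x y. \<eta> * g x y" v \<alpha> \<beta> \<gamma>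
    using assms by unfold_locales (simp_all add: is_A51_def inner_product_scale)
  show ?thesis
    using nilsoliton_iff_scaled[OF assms(2,3) linear_ricci ric_eq bilinear_br]
      derivation_ricci_iff[OF assms(7,8)] by simp
qed

end
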